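(* Let $X$ be a separable compact Hausdorff space, let $\sigma:X\to X$ be a homeomorphism, and assume that $(X,\sigma)$ is an extension of a free minimal system. Then, for any $\varepsilon>0$ and any $N\in\mathbb N$, there is a closed set $B\subseteq X$ such that the sets $\sigma^i(B)$, $i=0,\dots,N-1$, are disjoint and $$\mathrm{ocap}\Big(X\setminus\bigsqcup_{i=0}^{N-1}\sigma^i(B)\Big)<\varepsilon.$$ In particular, $(X,\sigma)$ has the Uniform Rokhlin Property (URP) (with $S=1$).
   Context: $(X,\sigma)$ is regarded as a $\mathbb Z$-action. It is an extension of $(Y,\sigma_Y)$ ($Y$ separable compact Hausdorff, $\sigma_Y$ a homeomorphism of $Y$) if there is a continuous surjection $\pi:X\to Y$ with $\pi\circ\sigma=\sigma_Y\circ\pi$. A system is free if no nonzero power of the homeomorphism has a fixed point, and minimal if $\varnothing$ and the whole space are the only closed invariant sets. For a right action of a discrete amenable group $\Gamma$ on $X$: a finite set $F\subseteq\Gamma$ is $(K,\varepsilon)$-invariant ($K\subseteq\Gamma$ finite) if $|FK\Delta F|/|F|<\varepsilon$; a Følner sequence is a sequence $(\Gamma_n)$ of finite subsets of $\Gamma$ that are eventually $(K,\varepsilon)$-invariant for every $(K,\varepsilon)$; the orbit capacity of $E\subseteq X$ is $\mathrm{ocap}(E)=\lim_n\frac1{|\Gamma_n|}\sup_{x\in X}\sum_{\gamma\in\Gamma_n}\chi_E(x\gamma)$ (independent of the Følner sequence); for $\Gamma=\mathbb Z$ this is $\lim_n\frac1n\sup_{x\in X}\sum_{i=0}^{n-1}\chi_E(\sigma^i(x))$.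 (URP): for every $\varepsilon>0$ and finite $K\subseteq\Gamma$ there exist closed sets $B_1,\dots,B_S\subseteq X$ and $(K,\varepsilon)$-invariant finite sets $\Gamma_1,\dots,\Gamma_S\subseteq\Gamma$ such that the sets $B_s\gamma$ ($\gamma\in\Gamma_s$, $s=1,\dots,S$) are mutually disjoint and $\mathrm{ocap}(X\setminus\bigsqcup_s\bigsqcup_{\gamma\in\Gamma_s}B_s\gamma)<\varepsilon$. *)

theory Defs
  imports "HOL-Analysis.Analysis"
begin

text \<open>
  The discrete group is a type of class \<^class>\<open>group_add\<close>, i.e. it is written additively, but it is
  not assumed to be commutative. A right action on the space \<open>X\<close> is a function
  \<open>act :: 'x \<Rightarrow> 'g \<Rightarrow> 'x\<close>, with \<open>act x g\<close> for the usual \<open>x g\<close>.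
\<close>

definition set_prod :: "'g::group_add set \<Rightarrow> 'g set \<Rightarrow> 'g set" where
  "set_prod F K = {f + k | f k. f \<in> F \<and> k \<in> K}"

text \<open>
  \<open>F\<close> has to be nonempty, as otherwise the quotient is the junk value \<open>0 / 0 = 0\<close>.
\<close>

definition invariant_set :: "'g::group_add set \<Rightarrow> real \<Rightarrow> 'g set \<Rightarrow> bool" where
  "invariant_set K \<epsilon> F \<longleftrightarrow>
     finite F \<and> F \<noteq> {} \<and> real (card (sym_diff (set_prod F K) F)) / real (card F) < \<epsilon>"

text \<open>
  Here and in the uniform Rokhlin property, \<open>K\<close> ranges over the nonempty finite sets: the quotient
  in \<^const>\<open>invariant_set\<close> is \<open>1\<close> for \<open>K = {}\<close>, so that no set would be \<open>(K, \<epsilon>)\<close>-invariant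
  for \<open>\<epsilon> \<le> 1\<close>.
\<close>

definition folner_sequence :: "(nat \<Rightarrow> 'g::group_add set) \<Rightarrow> bool" where
  "folner_sequence \<Gamma> \<longleftrightarrow> (\<forall>n. finite (\<Gamma> n)) \<and>
     (\<forall>K \<epsilon>. finite K \<and> K \<noteq> {} \<and> \<epsilon> > 0 \<longrightarrow> (\<forall>\<^sub>F n in sequentially. invariant_set K \<epsilon> (\<Gamma> n)))"

text \<open>
  The supremum is taken in the natural numbers, where it is \<open>0\<close> for the empty space.
\<close>

definition max_visits :: "'x topology \<Rightarrow> ('x \<Rightarrow> 'g \<Rightarrow> 'x) \<Rightarrow> 'x set \<Rightarrow> 'g set \<Rightarrow> nat" where
  "max_visits X act E F = (SUP x\<in>topspace X. \<Sum>g\<in>F. indicator E (act x g))"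

text \<open>
  The common limit along all Folner sequences. It exists by \<open>tendsto_max_visits\<close> below whenever
  there is a Folner sequence; the integers are covered by \<open>ocap_int_action\<close>.
\<close>

definition ocap :: "'x topology \<Rightarrow> ('x \<Rightarrow> 'g::group_add \<Rightarrow> 'x) \<Rightarrow> 'x set \<Rightarrow> real" where
  "ocap X act E = (THE c. \<forall>\<Gamma>. folner_sequence \<Gamma> \<longrightarrow>
     (\<lambda>n. real (max_visits X act E (\<Gamma> n)) / real (card (\<Gamma> n))) \<longlonglongrightarrow> c)"

definition rokhlin_towers ::
  "'x topology \<Rightarrow> ('x \<Rightarrow> 'g::group_add \<Rightarrow> 'x) \<Rightarrow> 'g set \<Rightarrow> real \<Rightarrow> nat \<Rightarrow>
     (nat \<Rightarrow> 'x set) \<Rightarrow> (nat \<Rightarrow> 'g set) \<Rightarrow> bool" where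
  "rokhlin_towers X act K \<epsilon> S B \<Gamma> \<longleftrightarrow>
     (\<forall>s\<in>{1..S}. closedin X (B s) \<and> invariant_set K \<epsilon> (\<Gamma> s)) \<and>
     disjoint_family_on (\<lambda>(s, g). (\<lambda>x. act x g) ` B s) (SIGMA s:{1..S}. \<Gamma> s) \<and>
     ocap X act (topspace X - (\<Union>s\<in>{1..S}. \<Union>g\<in>\<Gamma> s. (\<lambda>x. act x g) ` B s)) < \<epsilon>"

definition URP :: "'x topology \<Rightarrow> ('x \<Rightarrow> 'g::group_add \<Rightarrow> 'x) \<Rightarrow> bool" where
  "URP X act \<longleftrightarrow>
     (\<forall>\<epsilon>>0. \<forall>K. finite K \<and> K \<noteq> {} \<longrightarrow> (\<exists>S\<ge>1. \<exists>B \<Gamma>. rokhlin_towers X act K \<epsilon> S B \<Gamma>))"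

definition URP_single_tower :: "'x topology \<Rightarrow> ('x \<Rightarrow> 'g::group_add \<Rightarrow> 'x) \<Rightarrow> bool" where
  "URP_single_tower X act \<longleftrightarrow>
     (\<forall>\<epsilon>>0. \<forall>K. finite K \<and> K \<noteq> {} \<longrightarrow> (\<exists>B \<Gamma>. rokhlin_towers X act K \<epsilon> 1 B \<Gamma>))"

definition int_action :: "'x topology \<Rightarrow> ('x \<Rightarrow> 'x) \<Rightarrow> 'x \<Rightarrow> int \<Rightarrow> 'x" where
  "int_action X \<sigma> x i =
     (if i \<ge> 0 then (\<sigma> ^^ nat i) x else (inv_into (topspace X) \<sigma> ^^ nat (- i)) x)"

definition free_system :: "'x topology \<Rightarrow> ('x \<Rightarrow> 'x) \<Rightarrow> bool" where
  "free_system X \<sigma> \<longleftrightarrow> (\<forall>i. i \<noteq> 0 \<longrightarrow> (\<forall>x\<in>topspace X. int_action X \<sigma> x i \<noteq> x))"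

text \<open>Invariant means invariant under the group action, i.e. \<open>\<sigma> ` C = C\<close> and not just \<open>\<sigma> ` C \<subseteq> C\<close>.\<close>

definition minimal_system :: "'x topology \<Rightarrow> ('x \<Rightarrow> 'x) \<Rightarrow> bool" where
  "minimal_system X \<sigma> \<longleftrightarrow> (\<forall>C. closedin X C \<and> \<sigma> ` C = C \<longrightarrow> C = {} \<or> C = topspace X)"

definition extension_via ::
  "'x topology \<Rightarrow> ('x \<Rightarrow> 'x) \<Rightarrow> 'y topology \<Rightarrow> ('y \<Rightarrow> 'y) \<Rightarrow> ('x \<Rightarrow> 'y) \<Rightarrow> bool" where
  "extension_via X \<sigma> Y \<sigma>\<^sub>Y \<pi> \<longleftrightarrow>
     continuous_map X Y \<pi> \<and> \<pi> ` topspace X = topspace Y \<and>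
     (\<forall>x\<in>topspace X. \<pi> (\<sigma> x) = \<sigma>\<^sub>Y (\<pi> x))"

definition right_action :: "'x topology \<Rightarrow> ('x \<Rightarrow> 'g::group_add \<Rightarrow> 'x) \<Rightarrow> bool" where
  "right_action X act \<longleftrightarrow>
     (\<forall>x\<in>topspace X. act x 0 = x \<and> (\<forall>g. act x g \<in> topspace X \<and> (\<forall>h. act x (g + h) = act (act x g) h)))"

lemma visits_le_card: "(\<Sum>g\<in>F. indicator E (act x g)) \<le> card F"
  for F :: "'g set" and act :: "'x \<Rightarrow> 'g \<Rightarrow> 'x"
proof -
  have "(\<Sum>g\<in>F. indicator E (act x g)) \<le> (\<Sum>g\<in>F. 1::nat)"
    by (rule sum_mono) (simp add: indicator_def)
  then show ?thesis by simp
qed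

lemma visits_le_max_visits:
  assumes "x \<in> topspace X"
  shows "(\<Sum>g\<in>F. indicator E (act x g)) \<le> max_visits X act E F"
  unfolding max_visits_def
  by (rule cSUP_upper[OF assms]) (auto intro!: bdd_aboveI2 visits_le_card)

lemma max_visits_attained:
  assumes "topspace X \<noteq> {}"
  obtains x where "x \<in> topspace X" "max_visits X act E F = (\<Sum>g\<in>F. indicator E (act x g))"
proof -
  let ?A = "(\<lambda>x. \<Sum>g\<in>F. indicator E (act x g) :: nat) ` topspace X"
  have "bdd_above ?A" by (auto intro!: bdd_aboveI2 visits_le_card)
  then have "Sup ?A \<in> ?A" using assms by (simp add: Sup_nat_def bdd_above_nat)
  then show thesis using that unfolding max_visits_def by auto
qed

lemma max_visits_le:
  fixes F G :: "'g::group_add set"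
  assumes act: "right_action X act" and F: "finite F" and G: "finite G"
  shows "card G * max_visits X act E F \<le>
    card F * max_visits X act E G + (\<Sum>g\<in>G. card (sym_diff (set_prod F {g}) F))"
proof (cases "topspace X = {}")
  case True
  then show ?thesis by (simp add: max_visits_def)
next
  case False
  then obtain x where x: "x \<in> topspace X"
    and eq: "max_visits X act E F = (\<Sum>f\<in>F. indicator E (act x f))"
    by (rule max_visits_attained)
  let ?v = "\<lambda>A. \<Sum>f\<in>A. indicator E (act x f) :: nat"
  have sh: "set_prod F {g} = (\<lambda>f. f + g) ` F" for g
    by (auto simp: set_prod_def)
  have "?v F \<le> (\<Sum>f\<in>F. indicator E (act x (f + g))) + card (sym_diff (set_prod F {g}) F)" for g
  proof -
    let ?P = "set_prod F {g}"
    have fin: "finite ?P" using F by (simp add: sh)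
    have "?v F \<le> ?v (?P \<union> sym_diff ?P F)"
      using F fin by (intro sum_mono2) auto
    also have "\<dots> \<le> ?v ?P + ?v (sym_diff ?P F)"
      using F fin by (simp add: sum_Un_nat)
    also have "?v (sym_diff ?P F) \<le> card (sym_diff ?P F)" by (rule visits_le_card)
    also have "?v ?P = (\<Sum>f\<in>F. indicator E (act x (f + g)))"
      unfolding sh by (subst sum.reindex) (auto simp: inj_on_def)
    finally show ?thesis by simp
  qed
  then have "(\<Sum>g\<in>G. ?v F) \<le>
     (\<Sum>g\<in>G. (\<Sum>f\<in>F. indicator E (act x (f + g))) + card (sym_diff (set_prod F {g}) F))"
    by (intro sum_mono)
  also have "\<dots> = (\<Sum>f\<in>F. \<Sum>g\<in>G. indicator E (act (act x f) g))
      + (\<Sum>g\<in>G. card (sym_diff (set_prod F {g}) F))"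
    using act x by (simp add: sum.distrib right_action_def) (rule sum.swap)
  also have "(\<Sum>f\<in>F. \<Sum>g\<in>G. indicator E (act (act x f) g)) \<le> (\<Sum>f\<in>F. max_visits X act E G)"
    using act x by (intro sum_mono visits_le_max_visits) (simp add: right_action_def)
  finally show ?thesis by (simp add: eq)
qed

lemma tendsto_max_visits:
  fixes \<Gamma> :: "nat \<Rightarrow> 'g::group_add set"
  assumes act: "right_action X act" and \<Gamma>: "folner_sequence \<Gamma>"
  shows "(\<lambda>n. real (max_visits X act E (\<Gamma> n)) / real (card (\<Gamma> n))) \<longlonglongrightarrow>
    (INF G\<in>{G. finite G \<and> G \<noteq> {}}. real (max_visits X act E G) / real (card G))"
    (is "?q \<longlonglongrightarrow> Inf (?r ` ?\<G>)")
proof (rule order_tendstoI)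
  have bdd: "bdd_below (?r ` ?\<G>)" by (rule bdd_belowI2[of _ 0]) simp
  have fin: "finite (\<Gamma> n)" for n using \<Gamma> by (simp add: folner_sequence_def)
  fix a
  show "\<forall>\<^sub>F n in sequentially. a < ?q n" if "a < Inf (?r ` ?\<G>)"
  proof -
    have "\<forall>\<^sub>F n in sequentially. invariant_set {0} 1 (\<Gamma> n)"
      using \<Gamma> by (simp add: folner_sequence_def)
    then show ?thesis
    proof eventually_elim
      case (elim n)
      then have "Inf (?r ` ?\<G>) \<le> ?q n"
        by (intro cINF_lower2[OF bdd, of "\<Gamma> n"]) (auto simp: invariant_set_def)
      then show ?case using that by simp
    qed
  qed
  show "\<forall>\<^sub>F n in sequentially. ?q n < a" if a: "Inf (?r ` ?\<G>) < a"
  proof -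
    have "{0} \<in> ?\<G>" by simp
    then obtain G where G: "finite G" "G \<noteq> {}" and less: "?r G < a"
      using cInf_lessD[OF _ a] by blast
    define d where "d = a - ?r G"
    have d: "d > 0" using less by (simp add: d_def)
    have cG: "real (card G) > 0" using G by (simp add: card_gt_0_iff)
    have "\<forall>\<^sub>F n in sequentially. \<forall>g\<in>G. invariant_set {g} d (\<Gamma> n)"
      using \<Gamma> G d by (intro eventually_ball_finite) (auto simp: folner_sequence_def)
    then show ?thesis
    proof eventually_elim
      case (elim n)
      let ?D = "\<lambda>g. real (card (sym_diff (set_prod (\<Gamma> n) {g}) (\<Gamma> n)))"
      have cF: "real (card (\<Gamma> n)) > 0"
        using elim G by (auto simp: invariant_set_def card_gt_0_iff)
      have "?D g < d * card (\<Gamma> n)" if "g \<in> G" for g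
        using elim that cF by (simp add: invariant_set_def divide_less_eq)
      then have "(\<Sum>g\<in>G. ?D g) < (\<Sum>g\<in>G. d * card (\<Gamma> n))"
        using G by (intro sum_strict_mono) auto
      moreover have "real (card G * max_visits X act E (\<Gamma> n)) \<le>
          real (card (\<Gamma> n) * max_visits X act E G + (\<Sum>g\<in>G. card (sym_diff (set_prod (\<Gamma> n) {g}) (\<Gamma> n))))"
        by (rule of_nat_mono[OF max_visits_le[OF act fin G(1)]])
      ultimately have "card G * real (max_visits X act E (\<Gamma> n)) <
          card (\<Gamma> n) * real (max_visits X act E G) + card G * (d * card (\<Gamma> n))"
        by simp
      also have "\<dots> = card G * (card (\<Gamma> n) * a)"
        using cG by (simp add: d_def field_simps)
      finally have "real (max_visits X act E (\<Gamma> n)) < card (\<Gamma> n) * a"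
        using cG by simp
      then show ?case using cF by (simp add: divide_less_eq mult.commute)
    qed
  qed
qed

lemma ocap_eqI:
  assumes act: "right_action X act" and \<Gamma>: "folner_sequence \<Gamma>"
    and lim: "(\<lambda>n. real (max_visits X act E (\<Gamma> n)) / real (card (\<Gamma> n))) \<longlonglongrightarrow> c"
  shows "ocap X act E = c"
  unfolding ocap_def
proof (rule the_equality)
  have c: "c = (INF G\<in>{G. finite G \<and> G \<noteq> {}}. real (max_visits X act E G) / real (card G))"
    by (rule LIMSEQ_unique[OF lim tendsto_max_visits[OF act \<Gamma>]])
  show "\<forall>\<Gamma>. folner_sequence \<Gamma> \<longrightarrow>
      (\<lambda>n. real (max_visits X act E (\<Gamma> n)) / real (card (\<Gamma> n))) \<longlonglongrightarrow> c"
    unfolding c using tendsto_max_visits[OF act] by blast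
next
  fix c'
  assume "\<forall>\<Gamma>. folner_sequence \<Gamma> \<longrightarrow>
      (\<lambda>n. real (max_visits X act E (\<Gamma> n)) / real (card (\<Gamma> n))) \<longlonglongrightarrow> c'"
  then show "c' = c" using \<Gamma> lim LIMSEQ_unique by blast
qed

lemma ocap_tendsto:
  assumes "right_action X act" and "folner_sequence \<Gamma>"
  shows "(\<lambda>n. real (max_visits X act E (\<Gamma> n)) / real (card (\<Gamma> n))) \<longlonglongrightarrow> ocap X act E"
  using ocap_eqI[OF assms tendsto_max_visits[OF assms]] tendsto_max_visits[OF assms] by simp

lemma int_action_Suc_right:
  assumes bij: "bij_betw \<sigma> (topspace X) (topspace X)" and x: "x \<in> topspace X"
  shows "int_action X \<sigma> x (i + 1) = \<sigma> (int_action X \<sigma> x i) \<and> int_action X \<sigma> x i \<in> topspace X"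
proof -
  let ?\<tau> = "inv_into (topspace X) \<sigma>"
  have \<tau>: "?\<tau> y \<in> topspace X" "\<sigma> (?\<tau> y) = y" if "y \<in> topspace X" for y
    using that bij by (auto simp: bij_betw_def inv_into_into f_inv_into_f)
  have s: "(\<sigma> ^^ n) x \<in> topspace X" for n
    by (induction n) (use x bij in \<open>auto simp: bij_betw_def\<close>)
  have t: "(?\<tau> ^^ n) x \<in> topspace X" for n
    by (induction n) (use x \<tau> in auto)
  show ?thesis
  proof (cases "i \<ge> 0")
    case True
    then show ?thesis using s by (simp add: int_action_def nat_add_distrib)
  next
    case False
    define n where "n = nat (- i - 1)"
    have "i = - int (Suc n)" using False by (simp add: n_def)
    then show ?thesis using t \<tau>
      by (cases "n = 0") (auto simp: int_action_def x nat_add_distrib)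
  qed
qed

lemma right_action_int_action:
  assumes bij: "bij_betw \<sigma> (topspace X) (topspace X)"
  shows "right_action X (int_action X \<sigma>)"
proof -
  note step = int_action_Suc_right[OF bij]
  have inj: "inj_on \<sigma> (topspace X)" using bij by (simp add: bij_betw_def)
  have "int_action X \<sigma> x (i + j) = int_action X \<sigma> (int_action X \<sigma> x i) j"
    if x: "x \<in> topspace X" for x i j
  proof (induction j rule: int_induct[of _ 0])
    case base
    then show ?case by (simp add: int_action_def)
  next
    case (step1 j)
    then show ?case
      using step x by (metis add.assoc)
  next
    case (step2 j)
    have "\<sigma> (int_action X \<sigma> x (i + (j - 1))) = int_action X \<sigma> x (i + j)"
      using step[OF x, of "i + (j - 1)"] by simp
    also have "\<dots> = \<sigma> (int_action X \<sigma> (int_action X \<sigma> x i) (j - 1))"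
      using step[of "int_action X \<sigma> x i" "j - 1"] step[OF x, of i] step2 by simp
    finally show ?case
      using inj step x by (meson inj_onD)
  qed
  then show ?thesis
    using step by (simp add: right_action_def) (simp add: int_action_def)
qed

lemma folner_sequence_int: "folner_sequence (\<lambda>n. {0..<int n})"
  unfolding folner_sequence_def
proof (intro conjI allI impI)
  fix K :: "int set" and \<epsilon> :: real
  assume asm: "finite K \<and> K \<noteq> {} \<and> \<epsilon> > 0"
  define m where "m = Max (abs ` K)"
  have m: "\<bar>k\<bar> \<le> m" if "k \<in> K" for k using that asm by (simp add: m_def)
  then have m0: "m \<ge> 0" using asm by (metis abs_ge_zero all_not_in_conv order_trans)
  have "(\<lambda>n. real_of_int (4 * m) / real n) \<longlonglongrightarrow> 0" by (rule lim_const_over_n)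
  then have "\<forall>\<^sub>F n in sequentially. real_of_int (4 * m) / real n < \<epsilon>"
    using asm by (simp add: order_tendstoD(2))
  then show "\<forall>\<^sub>F n in sequentially. invariant_set K \<epsilon> {0..<int n}"
    using eventually_gt_at_top[of 0]
  proof eventually_elim
    case (elim n)
    let ?F = "{0..<int n}"
    obtain k where k: "k \<in> K" using asm by blast
    have "sym_diff (set_prod ?F K) ?F \<subseteq> {-m..<m} \<union> {int n - m..<int n + m}"
    proof
      fix z assume z: "z \<in> sym_diff (set_prod ?F K) ?F"
      show "z \<in> {-m..<m} \<union> {int n - m..<int n + m}"
      proof (cases "z \<in> ?F")
        case True
        then have "z \<notin> set_prod ?F K" using z by blast
        then have "z - k \<notin> ?F" using k by (force simp: set_prod_def)
        then show ?thesis using True m[OF k] by auto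
      next
        case False
        then obtain f l where "f \<in> ?F" "l \<in> K" "z = f + l" using z by (auto simp: set_prod_def)
        then show ?thesis using False m[of l] by auto
      qed
    qed
    then have "card (sym_diff (set_prod ?F K) ?F) \<le> card ({-m..<m} \<union> {int n - m..<int n + m})"
      by (intro card_mono) auto
    also have "\<dots> \<le> nat (4 * m)"
      by (rule order_trans[OF card_Un_le]) (use m0 in simp)
    finally have "real (card (sym_diff (set_prod ?F K) ?F)) \<le> real_of_int (4 * m)"
      using m0 by linarith
    then have "real (card (sym_diff (set_prod ?F K) ?F)) / real n \<le> real_of_int (4 * m) / real n"
      by (intro divide_right_mono) auto
    then show ?case using elim by (simp add: invariant_set_def)
  qed
qed simp

lemma ocap_int_action:
  assumes bij: "bij_betw \<sigma> (topspace X) (topspace X)"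
  shows "(\<lambda>n. real (SUP x\<in>topspace X. \<Sum>i<n. indicator E ((\<sigma> ^^ i) x)) / real n)
    \<longlonglongrightarrow> ocap X (int_action X \<sigma>) E"
proof -
  have "max_visits X (int_action X \<sigma>) E {0..<int n} =
      (SUP x\<in>topspace X. \<Sum>i<n. indicator E ((\<sigma> ^^ i) x))" for n
  proof -
    have eq: "{0..<int n} = int ` {..<n}" by (simp add: image_int_atLeastLessThan lessThan_atLeast0)
    show ?thesis unfolding max_visits_def eq
      by (subst sum.reindex) (auto simp: int_action_def)
  qed
  then show ?thesis
    using ocap_tendsto[OF right_action_int_action[OF bij] folner_sequence_int, of E] by simp
qed

end

theory Submission
  imports Defs
begin

text \<open>
  Minimality and freeness of \<open>Y\<close> give a continuous function \<open>w\<close> whose support every orbit visits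
  only rarely, while the points with \<open>w = 1\<close> are visited with bounded gaps. From \<open>w\<close> one builds a
  continuous real function on \<open>X\<close> that changes by exactly \<open>1\<close> along the orbit whenever \<open>w = 0\<close>
  (Lindenstrauss), and the base of the tower is read off from its value modulo a period. Since the
  orbit capacity is the infimum of \<open>max_visits / card\<close> over all finite windows, it is enough to bound
  the number of visits to the complement of the tower in one window, chosen so short that it meets
  the support of \<open>w\<close> at most once.
\<close>

section \<open>Iterates and bounded return times in minimal systems\<close>

lemma continuous_map_funpow:
  assumes "continuous_map X X \<sigma>"
  shows "continuous_map X X (\<sigma> ^^ n)"
proof (induction n)
  case (Suc n)
  then show ?case unfolding funpow.simps by (rule continuous_map_compose[OF _ assms])
qed (simp add: id_def)

lemma funpow_in_topspace:
  assumes "continuous_map X X \<sigma>" and "x \<in> topspace X"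
  shows "(\<sigma> ^^ n) x \<in> topspace X"
  using continuous_map_image_subset_topspace[OF continuous_map_funpow[OF assms(1)]] assms(2) by blast

text \<open>The points whose two-sided orbit avoids \<open>V\<close> form a closed invariant proper
  subset, which minimality makes empty. Compactness then bounds the time needed to reach
  \<open>V\<close>.\<close>

lemma minimal_system_return:
  assumes cpt: "compact_space Y" and hom: "homeomorphic_map Y Y \<sigma>"
    and min: "minimal_system Y \<sigma>" and V: "openin Y V" "V \<noteq> {}"
  obtains R where "\<And>y. y \<in> topspace Y \<Longrightarrow> \<exists>n\<le>R. (\<sigma> ^^ n) y \<in> V"
proof -
  have homn: "homeomorphic_map Y Y (\<sigma> ^^ n)" for n
  proof (induction n)
    case (Suc n)
    then show ?case unfolding funpow.simps by (rule homeomorphic_map_compose[OF _ hom])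
  qed (simp add: homeomorphic_map_id[unfolded id_def] id_def)
  have inj: "inj_on (\<sigma> ^^ n) (topspace Y)" for n
    using homn homeomorphic_imp_injective_map by blast
  have im: "(\<sigma> ^^ n) ` topspace Y = topspace Y" for n
    using homn homeomorphic_imp_surjective_map by blast
  have VY: "V \<subseteq> topspace Y" using V openin_subset by blast
  \<comment> \<open>A visit to \<open>V\<close> at time \<open>n\<close> or at time
    \<open>-n\<close>; the image under the iterate stands for the visit in the past.\<close>
  define P where "P n = {y \<in> topspace Y. (\<sigma> ^^ n) y \<in> V} \<union> (\<sigma> ^^ n) ` V" for n
  have "openin Y {y \<in> topspace Y. (\<sigma> ^^ n) y \<in> V}" for n
    using openin_continuous_map_preimage[OF homeomorphic_imp_continuous_map[OF homn] V(1)] .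
  moreover have "openin Y ((\<sigma> ^^ n) ` V)" for n
    using homeomorphic_map_openness[OF homn VY] V by blast
  ultimately have op: "openin Y (P n)" for n
    unfolding P_def by (rule openin_Un)
  define C where "C = topspace Y - (\<Union>n. P n)"
  \<comment> \<open>Minimality speaks of sets equal to their image, so both directions are needed.
    One step along the orbit shifts the visit time by one, which can turn a visit in the future into
    one in the past and conversely.\<close>
  have C_iff: "y \<in> C \<longleftrightarrow> \<sigma> y \<in> C" if y: "y \<in> topspace Y" for y
  proof -
    have sy: "\<sigma> y \<in> topspace Y" using im[of 1] y by auto
    have "(\<exists>n. y \<in> P n) \<longleftrightarrow> (\<exists>n. \<sigma> y \<in> P n)"
    proof
      assume "\<exists>n. y \<in> P n"
      then obtain n where "y \<in> P n" ..
      then consider (pre) "(\<sigma> ^^ n) y \<in> V" | (im) "y \<in> (\<sigma> ^^ n) ` V"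
        by (auto simp: P_def)
      then show "\<exists>n. \<sigma> y \<in> P n"
      proof cases
        case pre
        show ?thesis
        proof (cases n)
          case 0
          then have "\<sigma> y \<in> P 1" using pre by (simp add: P_def)
          then show ?thesis ..
        next
          case (Suc m)
          then have "\<sigma> y \<in> P m" using pre sy by (simp add: P_def funpow_swap1)
          then show ?thesis ..
        qed
      next
        case im
        then have "\<sigma> y \<in> P (Suc n)" by (auto simp: P_def)
        then show ?thesis ..
      qed
    next
      assume "\<exists>n. \<sigma> y \<in> P n"
      then obtain n where "\<sigma> y \<in> P n" ..
      then consider (pre) "(\<sigma> ^^ n) (\<sigma> y) \<in> V" | (im) "\<sigma> y \<in> (\<sigma> ^^ n) ` V"
        by (auto simp: P_def)
      then show "\<exists>n. y \<in> P n"
      proof cases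
        case pre
        then have "y \<in> P (Suc n)" using y by (simp add: P_def funpow_swap1)
        then show ?thesis ..
      next
        case img: im
        show ?thesis
        proof (cases n)
          case 0
          then have "y \<in> P 1" using img y by (simp add: P_def)
          then show ?thesis ..
        next
          case (Suc m)
          then obtain v where v: "v \<in> V" "\<sigma> y = \<sigma> ((\<sigma> ^^ m) v)" using img by auto
          then have "(\<sigma> ^^ m) v \<in> topspace Y" using VY im by blast
          then have "y = (\<sigma> ^^ m) v" using v y inj[of 1] by (auto dest: inj_onD)
          then have "y \<in> P m" using v by (auto simp: P_def)
          then show ?thesis ..
        qed
      qed
    qed
    then show ?thesis using y sy by (auto simp: C_def)
  qed
  have "\<sigma> ` C = C"
  proof
    show "\<sigma> ` C \<subseteq> C" using C_iff by (auto simp: C_def)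
    show "C \<subseteq> \<sigma> ` C"
    proof
      fix c assume c: "c \<in> C"
      then have "c \<in> topspace Y" by (simp add: C_def)
      then obtain y where "y \<in> topspace Y" "c = \<sigma> y" using im[of 1] by force
      then show "c \<in> \<sigma> ` C" using C_iff c by auto
    qed
  qed
  moreover have "closedin Y C" unfolding C_def using op by (intro closedin_diff) auto
  ultimately have "C = {} \<or> C = topspace Y" using min by (simp add: minimal_system_def)
  moreover have "V \<subseteq> P 0" using VY by (auto simp: P_def)
  ultimately have "topspace Y \<subseteq> (\<Union>n. P n)" using V VY unfolding C_def by blast
  then obtain F where F: "finite F" "F \<subseteq> range P" "topspace Y \<subseteq> \<Union>F"
    using cpt op unfolding compact_space_alt by (metis (no_types, lifting) imageE)
  then obtain A where A: "finite A" "F = P ` A" by (meson finite_subset_image)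
  obtain R where R: "\<And>n. n \<in> A \<Longrightarrow> n \<le> R" using A finite_nat_set_iff_bounded_le by auto
  show thesis
  proof
    fix y assume y: "y \<in> topspace Y"
    then have sy: "(\<sigma> ^^ k) y \<in> topspace Y" for k using im by blast
    \<comment> \<open>The cover is applied at time \<open>R\<close> instead of time
      \<open>0\<close>: a visit up to \<open>R\<close> steps earlier then still has a nonnegative
      time, at the price of the bound \<open>2 * R\<close>.\<close>
    then obtain n where n: "n \<le> R" "(\<sigma> ^^ R) y \<in> P n" using F A R by blast
    then consider (pre) "(\<sigma> ^^ n) ((\<sigma> ^^ R) y) \<in> V" | (im) v where "v \<in> V" "(\<sigma> ^^ R) y = (\<sigma> ^^ n) v"
      by (auto simp: P_def)
    then show "\<exists>n\<le>2 * R. (\<sigma> ^^ n) y \<in> V"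
    proof cases
      case pre
      then have "(\<sigma> ^^ (n + R)) y \<in> V" by (simp add: funpow_add)
      then show ?thesis using n by (intro exI[of _ "n + R"]) simp
    next
      case im
      have "(\<sigma> ^^ n) ((\<sigma> ^^ (R - n)) y) = (\<sigma> ^^ (n + (R - n))) y"
        by (simp only: funpow_add o_apply)
      then have "(\<sigma> ^^ n) ((\<sigma> ^^ (R - n)) y) = (\<sigma> ^^ n) v" using im n by simp
      then have "(\<sigma> ^^ (R - n)) y = v" using inj sy VY im by (meson inj_onD subsetD)
      then show ?thesis using im by (intro exI[of _ "R - n"]) simp
    qed
  qed
qed

section \<open>Marker functions on a free minimal system\<close>

lemma separated_neighbourhood:
  assumes haus: "Hausdorff_space Y" and cont: "continuous_map Y Y \<sigma>"
    and y: "y \<in> topspace Y" and ne: "\<And>i. i \<in> {1..M} \<Longrightarrow> (\<sigma> ^^ i) y \<noteq> y"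
  obtains U where "openin Y U" "y \<in> U" "\<And>u i. u \<in> U \<Longrightarrow> i \<in> {1..M} \<Longrightarrow> (\<sigma> ^^ i) u \<notin> U"
proof -
  have contn: "continuous_map Y Y (\<sigma> ^^ n)" for n using continuous_map_funpow[OF cont] .
  have "\<exists>U. openin Y U \<and> y \<in> U \<and> (\<forall>u\<in>U. (\<sigma> ^^ i) u \<notin> U)" if i: "i \<in> {1..M}" for i
  proof -
    have "(\<sigma> ^^ i) y \<in> topspace Y" using cont y by (rule funpow_in_topspace)
    then obtain P Q where PQ: "openin Y P" "openin Y Q" "y \<in> P" "(\<sigma> ^^ i) y \<in> Q" "disjnt P Q"
      using haus y ne[OF i] unfolding Hausdorff_space_def by metis
    let ?U = "P \<inter> {u \<in> topspace Y. (\<sigma> ^^ i) u \<in> Q}"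
    have "openin Y ?U"
      using PQ openin_continuous_map_preimage[OF contn PQ(2)] by (intro openin_Int)
    then show ?thesis using PQ y by (intro exI[of _ ?U]) (auto simp: disjnt_iff)
  qed
  then obtain U where U: "\<And>i. i \<in> {1..M} \<Longrightarrow> openin Y (U i) \<and> y \<in> U i \<and> (\<forall>u\<in>U i. (\<sigma> ^^ i) u \<notin> U i)"
    by metis
  show thesis
  proof
    \<comment> \<open>The factor \<open>topspace Y\<close> covers \<open>M = 0\<close>, where the
      intersection of the empty family is the whole type.\<close>
    show "openin Y (\<Inter>(U ` {1..M}) \<inter> topspace Y)" using U by (intro openin_INT) auto
    show "y \<in> \<Inter>(U ` {1..M}) \<inter> topspace Y" using U y by auto
  qed (use U in blast)
qed

text \<open>Freeness gives an open set to which no point returns within \<open>M\<close> steps. A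
  Urysohn function vanishing outside it becomes the marker, and minimality bounds the waiting
  time.\<close>

lemma marker_function:
  assumes cpt: "compact_space Y" and haus: "Hausdorff_space Y" and hom: "homeomorphic_map Y Y \<sigma>"
    and free: "free_system Y \<sigma>" and min: "minimal_system Y \<sigma>"
  obtains w :: "'y \<Rightarrow> real" and R where "continuous_map Y euclideanreal w"
    "\<And>y i. y \<in> topspace Y \<Longrightarrow> i \<in> {1..M} \<Longrightarrow> w y \<noteq> 0 \<Longrightarrow> w ((\<sigma> ^^ i) y) = 0"
    "\<And>y. y \<in> topspace Y \<Longrightarrow> \<exists>n\<le>R. w ((\<sigma> ^^ n) y) = 1"
proof (cases "topspace Y = {}")
  case True
  then show thesis by (intro that[of "\<lambda>_. 0"]) auto
next
  case False
  then obtain y where y: "y \<in> topspace Y" by blast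
  note cont = homeomorphic_imp_continuous_map[OF hom]
  have "(\<sigma> ^^ i) y \<noteq> y" if "i \<in> {1..M}" for i
    using free[unfolded free_system_def, rule_format, of "int i" y] y that by (simp add: int_action_def)
  then obtain U where U: "openin Y U" "y \<in> U" "\<And>u i. u \<in> U \<Longrightarrow> i \<in> {1..M} \<Longrightarrow> (\<sigma> ^^ i) u \<notin> U"
    using separated_neighbourhood[OF haus cont y] by metis
  have "completely_regular_space Y"
    using cpt haus compact_Hausdorff_or_regular_imp_normal_space normal_imp_completely_regular_space
      Hausdorff_imp_t1_space by blast
  then obtain g :: "'y \<Rightarrow> real" where g: "continuous_map Y euclideanreal g" "g y = 1" "g ` (topspace Y - U) \<subseteq> {0}"
    using y U unfolding completely_regular_space_gen_alt'[OF zero_neq_one[symmetric, where 'a = real]] by metis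
  let ?V = "{y \<in> topspace Y. g y \<in> {1/2<..}}"
  have "openin Y ?V" using g(1) by (intro openin_continuous_map_preimage) auto
  moreover have "?V \<noteq> {}" using g y by auto
  ultimately obtain R where R: "\<And>y. y \<in> topspace Y \<Longrightarrow> \<exists>n\<le>R. (\<sigma> ^^ n) y \<in> ?V"
    using minimal_system_return[OF cpt hom min] by metis
  \<comment> \<open>Recurrence needs an open target, which \<open>g = 1\<close> need not be.
    Doubling and truncating gives the value \<open>1\<close> on all of \<open>?V\<close> and keeps
    the zeros of \<open>g\<close>.\<close>
  define w where "w y = min 1 (2 * g y)" for y
  have supp: "y \<in> U" if "y \<in> topspace Y" "w y \<noteq> 0" for y
    using that g(3) by (auto simp: w_def)
  show thesis
  proof
    show "continuous_map Y euclideanreal w"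
      unfolding w_def using g(1) by (intro continuous_intros)
    show "w ((\<sigma> ^^ i) z) = 0" if "z \<in> topspace Y" "i \<in> {1..M}" "w z \<noteq> 0" for z i
      using supp[of z] supp[of "(\<sigma> ^^ i) z"] U(3)[of z i] that funpow_in_topspace[OF cont] by blast
    show "\<exists>n\<le>R. w ((\<sigma> ^^ n) z) = 1" if "z \<in> topspace Y" for z
      using R[OF that] by (auto simp: w_def)
  qed
qed

section \<open>A countdown along orbits\<close>

text \<open>
  The witness is the expected lifetime of a walker that starts at \<open>x\<close>, moves along the orbit and is
  killed at each point \<open>z\<close> with probability \<open>w z\<close> (for \<open>w\<close> with values in \<open>[0, 1]\<close>).
\<close>

lemma countdown_function:
  fixes w :: "'x \<Rightarrow> real"
  assumes cont: "continuous_map X X \<sigma>" and w: "continuous_map X euclideanreal w"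
    and hit: "\<And>x. x \<in> topspace X \<Longrightarrow> \<exists>n\<le>R. w ((\<sigma> ^^ n) x) = 1"
  obtains f :: "'x \<Rightarrow> real" where "continuous_map X euclideanreal f"
    "\<And>x. x \<in> topspace X \<Longrightarrow> w x = 0 \<Longrightarrow> f (\<sigma> x) = f x - 1"
proof
  let ?f = "\<lambda>x. \<Sum>n\<le>R. \<Prod>k\<le>n. 1 - w ((\<sigma> ^^ k) x)"
  have "continuous_map X euclideanreal (\<lambda>x. w ((\<sigma> ^^ k) x))" for k
    using continuous_map_compose[OF continuous_map_funpow[OF cont] w] by (simp add: o_def)
  then show "continuous_map X euclideanreal ?f"
    by (intro continuous_intros) auto
  fix x assume x: "x \<in> topspace X" "w x = 0"
  let ?p = "\<lambda>n. \<Prod>k\<le>n. 1 - w ((\<sigma> ^^ k) (\<sigma> x))"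
  have "\<sigma> x \<in> topspace X" using funpow_in_topspace[OF cont, of x 1] x by simp
  \<comment> \<open>The orbit of \<open>\<sigma> x\<close> meets \<open>w = 1\<close> by time
    \<open>R\<close>, so a factor is zero; cutting the series off at \<open>R\<close> loses
    nothing.\<close>
  then have last: "?p R = 0" using hit[of "\<sigma> x"] by (simp add: prod_zero_iff) force
  \<comment> \<open>As \<open>w x = 0\<close>, the factor at time \<open>0\<close> is
    \<open>1\<close>. Dropping it leaves the products for \<open>\<sigma> x\<close>, and the empty
    product is the \<open>1\<close> by which the two values differ.\<close>
  have "?f x = (\<Sum>n\<le>R. \<Prod>k<n. 1 - w ((\<sigma> ^^ k) (\<sigma> x)))"
    using x by (simp add: prod.atMost_shift funpow_swap1)
  also have "\<dots> = 1 + (\<Sum>n<R. ?p n)"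
    by (simp add: sum.atMost_shift lessThan_Suc_atMost)
  also have "(\<Sum>n<R. ?p n) = (\<Sum>n\<le>R. ?p n)"
    using last by (simp add: lessThan_Suc_atMost[symmetric])
  finally show "?f (\<sigma> x) = ?f x - 1" by simp
qed

section \<open>Orbit capacity from a single window\<close>

text \<open>The limit along any Folner sequence is the infimum over all nonempty finite windows, so
  each window gives an upper bound.\<close>

lemma ocap_le:
  fixes act :: "'x \<Rightarrow> 'g::group_add \<Rightarrow> 'x"
  assumes act: "right_action X act" and \<Gamma>: "folner_sequence (\<Gamma> :: nat \<Rightarrow> 'g set)"
    and F: "finite F" "F \<noteq> {}"
    and le: "\<And>x. x \<in> topspace X \<Longrightarrow> (\<Sum>g\<in>F. indicator E (act x g)) \<le> c"
  shows "ocap X act E \<le> real c / real (card F)"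
proof -
  have "ocap X act E = (INF G\<in>{G. finite G \<and> G \<noteq> {}}. real (max_visits X act E G) / real (card G))"
    by (rule ocap_eqI[OF act \<Gamma> tendsto_max_visits[OF act \<Gamma>]])
  also have "\<dots> \<le> real (max_visits X act E F) / real (card F)"
    using F by (intro cINF_lower bdd_belowI2[of _ 0]) auto
  also have "max_visits X act E F \<le> c"
  proof (cases "topspace X = {}")
    case False
    then show ?thesis unfolding max_visits_def by (intro cSUP_least le)
  qed (simp add: max_visits_def)
  finally show ?thesis by (simp add: divide_right_mono)
qed

section \<open>Towers over a periodic clock\<close>

text \<open>The set is the sum of the closed lattice of integer multiples of \<open>a\<close> and
  the compact interval from \<open>0\<close> to \<open>b\<close>.\<close>

lemma closed_periodic_interval:
  "closed {t::real. \<exists>p::int. of_int p * a \<le> t \<and> t \<le> of_int p * a + b}"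
proof -
  have "{t::real. \<exists>p::int. of_int p * a \<le> t \<and> t \<le> of_int p * a + b} =
      (\<Union>x\<in>(\<lambda>x. a *\<^sub>R x) ` \<int>. \<Union>y\<in>{0..b}. {x + y})"
    (is "?L = ?R")
  proof
    show "?L \<subseteq> ?R"
    proof
      fix t assume "t \<in> ?L"
      then obtain p :: int where "of_int p * a \<le> t \<and> t \<le> of_int p * a + b" by auto
      then show "t \<in> ?R"
        by (intro UN_I[of "of_int p * a"] UN_I[of "t - of_int p * a"] image_eqI[of _ _ "of_int p"]) auto
    qed
    show "?R \<subseteq> ?L"
    proof
      fix t assume "t \<in> ?R"
      then obtain p :: int and y where "t = a * of_int p + y" "0 \<le> y" "y \<le> b"
        by (auto elim!: Ints_cases)
      then show "t \<in> ?L" by (auto simp: mult.commute intro!: exI[of _ p])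
    qed
  qed
  then show ?thesis
    using closed_compact_sums[OF closed_scaling[OF closed_Ints], of "{0..b}" a] by simp
qed

text \<open>Two base times differ by a multiple of \<open>N * K\<close> up to an error of at most
  \<open>K - N\<close>, whereas \<open>d * (K + 1)\<close> keeps a distance greater than
  \<open>K - N\<close> from both \<open>0\<close> and \<open>N * K\<close>.\<close>

lemma tower_disjoint:
  fixes s t :: real and p q :: int and N K d :: nat
  assumes NK: "N \<le> K" and d: "0 < d" "d < N"
    and s: "of_int p * (real N * real K) \<le> s" "s \<le> of_int p * (real N * real K) + (real K - real N)"
    and t: "of_int q * (real N * real K) \<le> t" "t \<le> of_int q * (real N * real K) + (real K - real N)"
  shows "t \<noteq> s + real d * (real K + 1)"
proof
  assume eq: "t = s + real d * (real K + 1)"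
  have dK: "real K \<le> real d * real K" "real d * real K \<le> real N * real K - real K"
  proof -
    have "1 * real K \<le> real d * real K" using d by (intro mult_right_mono) auto
    then show "real K \<le> real d * real K" by simp
    have "(real d + 1) * real K \<le> real N * real K" using d by (intro mult_right_mono) auto
    then show "real d * real K \<le> real N * real K - real K" by (simp add: algebra_simps)
  qed
  have diff: "of_int (q - p) * (real N * real K) = of_int q * (real N * real K) - of_int p * (real N * real K)"
    "real d * (real K + 1) = real d * real K + real d"
    by (simp_all add: algebra_simps)
  have pos: "0 < real d" "real d < real N" using d by simp_all
  have "0 < of_int (q - p) * (real N * real K)"
    using s t eq dK pos diff by linarith
  then have "0 < q - p" by (auto simp: zero_less_mult_iff mult_less_0_iff)
  then have "1 * (real N * real K) \<le> of_int (q - p) * (real N * real K)"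
    by (intro mult_right_mono) auto
  moreover have "of_int (q - p) * (real N * real K) < real N * real K"
    using s t eq dK pos diff by linarith
  ultimately show False by simp
qed

text \<open>
  Up to sign and scale, \<open>f\<close> is a clock \<open>\<phi>\<close> that advances by \<open>K + 1\<close> per step off the rarely visited
  set \<open>w \<noteq> 0\<close>, and the base consists of the points whose time modulo \<open>N * K\<close> lies in
  \<open>[0, K - N]\<close>. Advancing by \<open>K + 1\<close> instead of \<open>K\<close> makes the time modulo \<open>K\<close> run through all residues,
  so that no orbit segment stays long in the gap \<open>(K - N, K)\<close> that closedness of the base forces.
\<close>

lemma closed_tower:
  fixes f w :: "'x \<Rightarrow> real" and K N :: nat
  assumes hom: "homeomorphic_map X X \<sigma>"
    and f: "continuous_map X euclideanreal f" and w: "continuous_map X euclideanreal w"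
    and step: "\<And>x. x \<in> topspace X \<Longrightarrow> w x = 0 \<Longrightarrow> f (\<sigma> x) = f x - 1"
    and sep: "\<And>x i. x \<in> topspace X \<Longrightarrow> i \<in> {1..K + 2 * N} \<Longrightarrow> w x \<noteq> 0 \<Longrightarrow> w ((\<sigma> ^^ i) x) = 0"
    and NK: "1 \<le> N" "N \<le> K"
  obtains B where "closedin X B" "disjoint_family_on (\<lambda>i. (\<sigma> ^^ i) ` B) {0..<N}"
    "ocap X (int_action X \<sigma>) (topspace X - (\<Union>i\<in>{0..<N}. (\<sigma> ^^ i) ` B)) \<le> real (6 * N + 1) / real K"
proof -
  have bij: "bij_betw \<sigma> (topspace X) (topspace X)"
    using hom by (simp add: bij_betw_def homeomorphic_imp_injective_map homeomorphic_imp_surjective_map)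
  note cont = homeomorphic_imp_continuous_map[OF hom]
  have bijn: "bij_betw (\<sigma> ^^ n) (topspace X) (topspace X)" for n
    using bij by (rule bij_betw_funpow)
  have top: "(\<sigma> ^^ n) x \<in> topspace X" if "x \<in> topspace X" for n x
    using cont that by (rule funpow_in_topspace)
  define \<phi> where "\<phi> x = - (real K + 1) * f x" for x
  have \<phi>_add: "\<phi> ((\<sigma> ^^ (a + d)) x) = \<phi> ((\<sigma> ^^ a) x) + real d * (real K + 1)"
    if "x \<in> topspace X" "\<And>l. a \<le> l \<Longrightarrow> l < a + d \<Longrightarrow> w ((\<sigma> ^^ l) x) = 0" for x a d
    using that(2)
  proof (induction d)
    case (Suc d)
    have "f ((\<sigma> ^^ (a + Suc d)) x) = f ((\<sigma> ^^ (a + d)) x) - 1"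
      using step[OF top[OF that(1)], of "a + d"] Suc.prems by simp
    then have "\<phi> ((\<sigma> ^^ (a + Suc d)) x) = \<phi> ((\<sigma> ^^ (a + d)) x) + (real K + 1)"
      unfolding \<phi>_def by (simp only:) (simp add: algebra_simps)
    moreover have "\<phi> ((\<sigma> ^^ (a + d)) x) = \<phi> ((\<sigma> ^^ a) x) + real d * (real K + 1)"
      using Suc by simp
    ultimately show ?case by (simp only: of_nat_Suc) (simp add: algebra_simps)
  qed simp
  define T where "T = {t::real. \<exists>p::int. of_int p * (real N * real K) \<le> t \<and>
      t \<le> of_int p * (real N * real K) + (real K - real N)}"
  \<comment> \<open>The zeros of \<open>w\<close> make the clock regular through all levels of the
    tower.\<close>
  define B where "B = {x \<in> topspace X. \<phi> x \<in> T} \<inter> (\<Inter>i\<in>{0..<N}. {x \<in> topspace X. w ((\<sigma> ^^ i) x) \<in> {0}})"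
  have "continuous_map X euclideanreal \<phi>"
    unfolding \<phi>_def using f by (intro continuous_intros)
  moreover have "continuous_map X euclideanreal (\<lambda>x. w ((\<sigma> ^^ i) x))" for i
    using continuous_map_compose[OF continuous_map_funpow[OF cont] w] by (simp add: o_def)
  ultimately have "closedin X B"
    unfolding B_def T_def using NK closed_periodic_interval
    by (intro closedin_Int closedin_INT closedin_continuous_map_preimage) auto
  moreover have "disjoint_family_on (\<lambda>i. (\<sigma> ^^ i) ` B) {0..<N}"
  proof -
    have "(\<sigma> ^^ i) ` B \<inter> (\<sigma> ^^ j) ` B = {}" if ij: "i < j" "j < N" for i j
    proof (rule ccontr)
      assume "(\<sigma> ^^ i) ` B \<inter> (\<sigma> ^^ j) ` B \<noteq> {}"
      then obtain b c where bc: "b \<in> B" "c \<in> B" "(\<sigma> ^^ i) b = (\<sigma> ^^ j) c" by auto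
      then have bcX: "b \<in> topspace X" "c \<in> topspace X" by (auto simp: B_def)
      have "(\<sigma> ^^ i) ((\<sigma> ^^ (j - i)) c) = (\<sigma> ^^ (i + (j - i))) c"
        by (simp only: funpow_add o_apply)
      then have "(\<sigma> ^^ i) ((\<sigma> ^^ (j - i)) c) = (\<sigma> ^^ i) b" using bc ij by simp
      then have b: "b = (\<sigma> ^^ (j - i)) c"
        using bijn[of i] bcX top by (metis bij_betw_def inj_onD)
      have "\<phi> b = \<phi> c + real (j - i) * (real K + 1)"
        using \<phi>_add[of c 0 "j - i"] bcX bc ij by (simp add: b B_def)
      moreover have "\<phi> b \<in> T" "\<phi> c \<in> T" using bc by (auto simp: B_def)
      ultimately show False
        using tower_disjoint[OF NK(2), of "j - i"] ij unfolding T_def by fastforce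
    qed
    then show ?thesis unfolding disjoint_family_on_def
      by (metis atLeastLessThan_iff inf_commute linorder_neqE_nat)
  qed
  moreover have "ocap X (int_action X \<sigma>) (topspace X - (\<Union>i\<in>{0..<N}. (\<sigma> ^^ i) ` B)) \<le> real (6 * N + 1) / real K"
    (is "ocap _ _ ?E \<le> _")
  proof -
    \<comment> \<open>The window starts at \<open>N\<close>, so going down fewer than
      \<open>N\<close> levels never leads before time \<open>0\<close>.\<close>
    have "card {j \<in> {N..<N + K}. (\<sigma> ^^ j) x \<in> ?E} \<le> 6 * N + 1" if x: "x \<in> topspace X" for x
    proof -
      \<comment> \<open>At most one time below \<open>K + 2 * N\<close> sees
        \<open>w \<noteq> 0\<close>; if there is none, any \<open>e\<close> will do.\<close>
      obtain e where e: "\<And>l. l < K + 2 * N \<Longrightarrow> l \<noteq> e \<Longrightarrow> w ((\<sigma> ^^ l) x) = 0"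
      proof (cases "\<exists>l < K + 2 * N. w ((\<sigma> ^^ l) x) \<noteq> 0")
        case True
        define m where "m = (LEAST l. w ((\<sigma> ^^ l) x) \<noteq> 0)"
        have m: "w ((\<sigma> ^^ m) x) \<noteq> 0" unfolding m_def using True by (metis (mono_tags, lifting) LeastI)
        show thesis
        proof (rule that[of m], rule ccontr)
          fix l assume l: "l < K + 2 * N" "l \<noteq> m" "w ((\<sigma> ^^ l) x) \<noteq> 0"
          then have "m < l" unfolding m_def by (metis (mono_tags, lifting) Least_le order_neq_le_trans)
          then have "l - m \<in> {1..K + 2 * N}" using l by auto
          then have "w ((\<sigma> ^^ (l - m)) ((\<sigma> ^^ m) x)) = 0" by (rule sep[OF top[OF x] _ m])
          moreover have "(\<sigma> ^^ (l - m)) ((\<sigma> ^^ m) x) = (\<sigma> ^^ (l - m + m)) x"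
            by (simp only: funpow_add o_apply)
          ultimately show False using l \<open>m < l\<close> by simp
        qed
      qed (use that in blast)
      define a where "a j = \<lfloor>\<phi> ((\<sigma> ^^ j) x)\<rfloor>" for j
      \<comment> \<open>Only the step from \<open>e\<close> to \<open>e + 1\<close> may be
        irregular, so a stretch may end at \<open>e\<close> but not cross it.\<close>
      have a_add: "a j = a i + int (j - i) * (int K + 1)"
        if "i \<le> j" "j < K + 2 * N" "e < i \<or> j \<le> e" for i j
      proof -
        have "\<phi> ((\<sigma> ^^ (i + (j - i))) x) = \<phi> ((\<sigma> ^^ i) x) + real (j - i) * (real K + 1)"
          by (rule \<phi>_add[OF x], rule e) (use that in auto)
        then have "\<phi> ((\<sigma> ^^ j) x) = \<phi> ((\<sigma> ^^ i) x) + of_int (int (j - i) * (int K + 1))"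
          using that by simp
        then show ?thesis unfolding a_def by (simp only: floor_add_int)
      qed
      define bad where "bad = {0..<int N} \<union> {int K - int N..<int K}"
      \<comment> \<open>On either side of \<open>e\<close>, \<open>a j\<close> grows by
        \<open>1\<close> modulo \<open>K\<close> per step. As the window has length
        \<open>K\<close>, each bad residue occurs at most once.\<close>
      have count: "card {j \<in> J. a j mod int K \<in> bad} \<le> 2 * N"
        if J: "J \<subseteq> {N..<N + K}" "(\<forall>j\<in>J. e < j) \<or> (\<forall>j\<in>J. j \<le> e)" for J
      proof -
        have ne: "a i mod int K \<noteq> a j mod int K" if "i \<in> J" "j \<in> J" "i < j" for i j
        proof
          assume eq: "a i mod int K = a j mod int K"
          have "a j = a i + int (j - i) * (int K + 1)"
            by (rule a_add) (use that J in auto)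
          then have "a j = a i + int (j - i) + int K * int (j - i)" by (simp add: algebra_simps)
          then have "int K dvd int (j - i) + int K * int (j - i)"
            using eq by (metis add.assoc add_diff_cancel_left' mod_eq_dvd_iff)
          then have "int K dvd int (j - i)" by (simp add: dvd_add_left_iff)
          then have "K dvd j - i" by (simp only: int_dvd_int_iff)
          then have "K \<le> j - i" by (rule dvd_imp_le) (use that in simp)
          moreover have "i \<ge> N" "j < N + K" using J that by auto
          ultimately show False using that(3) by linarith
        qed
        have "inj_on (\<lambda>j. a j mod int K) {j \<in> J. a j mod int K \<in> bad}"
          by (rule inj_onI) (metis (no_types, lifting) ne mem_Collect_eq linorder_neqE_nat)
        then have "card {j \<in> J. a j mod int K \<in> bad} \<le> card bad"
          by (rule card_inj_on_le) (auto simp: bad_def)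
        also have "\<dots> \<le> 2 * N" unfolding bad_def by (rule order_trans[OF card_Un_le]) simp
        finally show ?thesis .
      qed
      have good: "(\<sigma> ^^ j) x \<notin> ?E"
        if j: "j \<in> {N..<N + K}" "j + N < e \<or> e + N < j" "a j mod int K \<notin> bad" for j
      proof -
        \<comment> \<open>The expansion \<open>a j = p * (N * K) + i * K + r\<close> shows the level
          \<open>i\<close>. Going down \<open>i\<close> levels takes \<open>i * K + i\<close> off
          the clock: \<open>r \<ge> N\<close> absorbs the extra \<open>i\<close>, and
          \<open>r + 1 \<le> K - N\<close> the fractional part. Distance from \<open>e\<close> keeps
          all times involved regular.\<close>
        define q where "q = a j div int K"
        define r where "r = a j mod int K"
        define p where "p = q div int N"
        define i where "i = nat (q mod int N)"
        have i: "i < N" "int i = q mod int N" using NK by (auto simp: i_def nat_less_iff)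
        have r: "int N \<le> r" "r + 1 \<le> int K - int N"
          using j(3) NK unfolding bad_def r_def by auto
        have "a j = q * int K + r" "q = p * int N + int i"
          by (simp_all add: q_def r_def p_def i)
        then have "a j = p * (int N * int K) + int i * int K + r" by (simp add: algebra_simps)
        then have aj: "of_int (a j) = of_int p * (real N * real K) + real i * real K + of_int r" by simp
        let ?y = "(\<sigma> ^^ (j - i)) x"
        have "(\<sigma> ^^ i) ?y = (\<sigma> ^^ (i + (j - i))) x" by (simp only: funpow_add o_apply)
        then have y: "(\<sigma> ^^ j) x = (\<sigma> ^^ i) ?y" using i j by simp
        have "\<phi> ((\<sigma> ^^ (j - i + i)) x) = \<phi> ?y + real i * (real K + 1)"
          by (rule \<phi>_add[OF x], rule e) (use i j in auto)
        then have "\<phi> ((\<sigma> ^^ j) x) = \<phi> ?y + real i * real K + real i"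
          using i j by (simp add: algebra_simps)
        moreover have "of_int (a j) \<le> \<phi> ((\<sigma> ^^ j) x)" "\<phi> ((\<sigma> ^^ j) x) < of_int (a j) + 1"
          unfolding a_def by linarith+
        moreover have "real N \<le> of_int r" "of_int r + 1 \<le> real K - real N" "real i < real N"
          using r i by linarith+
        ultimately have "of_int p * (real N * real K) \<le> \<phi> ?y"
          "\<phi> ?y \<le> of_int p * (real N * real K) + (real K - real N)"
          using aj by linarith+
        then have "\<phi> ?y \<in> T" unfolding T_def by blast
        moreover have "w ((\<sigma> ^^ l) ?y) = 0" if "l < N" for l
        proof -
          have "w ((\<sigma> ^^ (l + (j - i))) x) = 0" by (rule e) (use i j that in auto)
          then show ?thesis by (simp add: funpow_add)
        qed
        ultimately have "?y \<in> B" using top x by (auto simp: B_def)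
        then show ?thesis using y i by auto
      qed
      let ?J1 = "{j \<in> {N..<N + K}. j + N < e}" and ?J2 = "{j \<in> {N..<N + K}. e + N < j}"
      let ?bad = "\<lambda>J. {j \<in> J. a j mod int K \<in> bad}"
      have "{j \<in> {N..<N + K}. (\<sigma> ^^ j) x \<in> ?E} \<subseteq> {e - N..e + N} \<union> (?bad ?J1 \<union> ?bad ?J2)"
        using good by fastforce
      then have "card {j \<in> {N..<N + K}. (\<sigma> ^^ j) x \<in> ?E} \<le> card ({e - N..e + N} \<union> (?bad ?J1 \<union> ?bad ?J2))"
        by (intro card_mono) auto
      also have "\<dots> \<le> card {e - N..e + N} + (card (?bad ?J1) + card (?bad ?J2))"
        by (meson add_left_mono card_Un_le order_trans)
      \<comment> \<open>The times within \<open>N\<close> of \<open>e\<close>, and at most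
        \<open>2 * N\<close> bad residues on either side.\<close>
      also have "\<dots> \<le> (2 * N + 1) + (2 * N + 2 * N)"
        by (intro add_mono count) auto
      finally show ?thesis by simp
    qed
    then have "(\<Sum>g\<in>int ` {N..<N + K}. indicator ?E (int_action X \<sigma> x g)) \<le> 6 * N + 1"
      if "x \<in> topspace X" for x
      using that by (subst sum.reindex)
        (auto simp: int_action_def indicator_def sum.If_cases Int_def cong: conj_cong)
    from ocap_le[OF right_action_int_action[OF bij] folner_sequence_int _ _ this]
    have "ocap X (int_action X \<sigma>) ?E \<le> real (6 * N + 1) / real (card (int ` {N..<N + K}))"
      using NK by simp
    then show ?thesis by (simp add: card_image)
  qed
  ultimately show thesis using that by blast
qed

section \<open>Transfer to the extension and the uniform Rokhlin property\<close>

theorem lemma3p6: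
  fixes X :: "'x topology" and \<sigma> :: "'x \<Rightarrow> 'x"
    and Y :: "'y topology" and \<sigma>\<^sub>Y :: "'y \<Rightarrow> 'y" and \<pi> :: "'x \<Rightarrow> 'y"
  assumes "separable_space X" and "compact_space X" and "Hausdorff_space X"
    and "homeomorphic_map X X \<sigma>"
    and "separable_space Y" and "compact_space Y" and "Hausdorff_space Y"
    and "homeomorphic_map Y Y \<sigma>\<^sub>Y"
    and "free_system Y \<sigma>\<^sub>Y" and "minimal_system Y \<sigma>\<^sub>Y"
    and "extension_via X \<sigma> Y \<sigma>\<^sub>Y \<pi>"
  shows "(\<forall>\<epsilon>>0. \<forall>N\<ge>1. \<exists>B. closedin X B \<and>
            disjoint_family_on (\<lambda>i. (\<sigma> ^^ i) ` B) {0..<N} \<and>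
            ocap X (int_action X \<sigma>) (topspace X - (\<Union>i\<in>{0..<N}. (\<sigma> ^^ i) ` B)) < \<epsilon>) \<and>
         URP X (int_action X \<sigma>) \<and> URP_single_tower X (int_action X \<sigma>)"
proof -
  note hom = assms(4)
  have cont: "continuous_map X X \<sigma>" using hom by (rule homeomorphic_imp_continuous_map)
  have \<pi>: "continuous_map X Y \<pi>" and \<pi>Y: "\<And>x. x \<in> topspace X \<Longrightarrow> \<pi> x \<in> topspace Y"
    and comm: "\<And>x. x \<in> topspace X \<Longrightarrow> \<pi> (\<sigma> x) = \<sigma>\<^sub>Y (\<pi> x)"
    using assms(11) by (auto simp: extension_via_def)
  have top: "(\<sigma> ^^ n) x \<in> topspace X" if "x \<in> topspace X" for n x
    using cont that by (rule funpow_in_topspace)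
  have comm_n: "\<pi> ((\<sigma> ^^ n) x) = (\<sigma>\<^sub>Y ^^ n) (\<pi> x)" if "x \<in> topspace X" for n x
    by (induction n) (use comm top that in auto)
  have tower: "\<exists>B. closedin X B \<and> disjoint_family_on (\<lambda>i. (\<sigma> ^^ i) ` B) {0..<N} \<and>
      ocap X (int_action X \<sigma>) (topspace X - (\<Union>i\<in>{0..<N}. (\<sigma> ^^ i) ` B)) < \<epsilon>"
    if \<epsilon>: "\<epsilon> > 0" and N: "N \<ge> 1" for \<epsilon> :: real and N :: nat
  proof -
    obtain K0 :: nat where K0: "real (6 * N + 1) / \<epsilon> < real K0" using reals_Archimedean2 by blast
    define K where "K = max K0 N"
    have K: "real (6 * N + 1) / \<epsilon> < real K" "N \<le> K" using K0 by (auto simp: K_def)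
    obtain v R where v: "continuous_map Y euclideanreal v"
      "\<And>y i. y \<in> topspace Y \<Longrightarrow> i \<in> {1..K + 2 * N} \<Longrightarrow> v y \<noteq> 0 \<Longrightarrow> v ((\<sigma>\<^sub>Y ^^ i) y) = 0"
      "\<And>y. y \<in> topspace Y \<Longrightarrow> \<exists>n\<le>R. v ((\<sigma>\<^sub>Y ^^ n) y) = 1"
      using marker_function[OF assms(6,7,8,9,10)] by metis
    \<comment> \<open>The factor map intertwines the two homeomorphisms, so the pullback inherits
      both rare visits and bounded gaps.\<close>
    define w where "w = v \<circ> \<pi>"
    have w: "continuous_map X euclideanreal w"
      unfolding w_def using \<pi> v(1) by (rule continuous_map_compose)
    have sep: "w ((\<sigma> ^^ i) x) = 0" if "x \<in> topspace X" "i \<in> {1..K + 2 * N}" "w x \<noteq> 0" for x i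
      using v(2)[OF \<pi>Y] that comm_n by (simp add: w_def)
    have "\<exists>n\<le>R. w ((\<sigma> ^^ n) x) = 1" if "x \<in> topspace X" for x
      using v(3)[OF \<pi>Y] that comm_n by (simp add: w_def)
    then obtain f where f: "continuous_map X euclideanreal f"
      "\<And>x. x \<in> topspace X \<Longrightarrow> w x = 0 \<Longrightarrow> f (\<sigma> x) = f x - 1"
      using countdown_function[OF cont w] by metis
    obtain B where B: "closedin X B" "disjoint_family_on (\<lambda>i. (\<sigma> ^^ i) ` B) {0..<N}"
      "ocap X (int_action X \<sigma>) (topspace X - (\<Union>i\<in>{0..<N}. (\<sigma> ^^ i) ` B)) \<le> real (6 * N + 1) / real K"
      using closed_tower[OF hom f(1) w f(2) sep N K(2)] by blast
    have "real (6 * N + 1) / real K < \<epsilon>"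
      using K N \<epsilon> by (simp add: field_simps)
    then show ?thesis using B by (intro exI[of _ B]) auto
  qed
  have single: "URP_single_tower X (int_action X \<sigma>)"
    unfolding URP_single_tower_def
  proof (intro allI impI)
    fix \<epsilon> :: real and K :: "int set" assume \<epsilon>: "\<epsilon> > 0" and K: "finite K \<and> K \<noteq> {}"
    then have "\<forall>\<^sub>F n in sequentially. invariant_set K \<epsilon> {0..<int n}"
      using folner_sequence_int by (simp add: folner_sequence_def)
    then obtain N where inv: "invariant_set K \<epsilon> {0..<int N}"
      by (auto simp: eventually_sequentially)
    \<comment> \<open>Invariant sets are nonempty by definition, which excludes
      \<open>N = 0\<close>.\<close>
    then have "N \<ge> 1" by (cases N) (auto simp: invariant_set_def)
    then obtain B where B: "closedin X B" "disjoint_family_on (\<lambda>i. (\<sigma> ^^ i) ` B) {0..<N}"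
      "ocap X (int_action X \<sigma>) (topspace X - (\<Union>i\<in>{0..<N}. (\<sigma> ^^ i) ` B)) < \<epsilon>"
      using tower \<epsilon> by blast
    have int: "{0..<int N} = int ` {0..<N}" by (simp add: image_int_atLeastLessThan)
    have "rokhlin_towers X (int_action X \<sigma>) K \<epsilon> 1 (\<lambda>_. B) (\<lambda>_. {0..<int N})"
      unfolding rokhlin_towers_def
    proof (intro conjI)
      show "disjoint_family_on (\<lambda>(s, g). (\<lambda>x. int_action X \<sigma> x g) ` B) (SIGMA s:{1..1::nat}. {0..<int N})"
        using B(2) unfolding int by (simp add: disjoint_family_on_def int_action_def)
      show "ocap X (int_action X \<sigma>) (topspace X - (\<Union>s\<in>{1..1::nat}. \<Union>g\<in>{0..<int N}.
          (\<lambda>x. int_action X \<sigma> x g) ` B)) < \<epsilon>"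
        using B(3) unfolding int by (simp add: int_action_def)
    qed (use B inv in auto)
    then show "\<exists>B \<Gamma>. rokhlin_towers X (int_action X \<sigma>) K \<epsilon> 1 B \<Gamma>" by blast
  qed
  moreover have "URP X (int_action X \<sigma>)"
    using single unfolding URP_single_tower_def URP_def by blast
  ultimately show ?thesis using tower by blast
qed

end
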